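(* Let $q$ be a prime power, $m\ge 1$, $1\le k\le q-1$ and $v=k+(m-1)(q-1)$. The projective lifted code $\mathrm{PLift}_q(m,k)$ is monomial; that is, there is a set $D\subseteq\{\mathbf d\in\mathbb N^{m+1} : d_0+\dots+d_m=v\}$ such that $\mathrm{PLift}_q(m,k)=\mathrm{ev}_{\mathbb P^m}(\mathrm{Poly}(D))$.
   Context: $\mathbb P^m=(\mathbb F_q^{m+1}\setminus\{0\})/\mathbb F_q^\times$. Each point of $\mathbb P^m$ has a unique standard representative, the one whose leftmost non-zero coordinate equals $1$. $\mathbb F_q[\mathbf X]^H_v$ is the space of homogeneous polynomials of degree $v$ in $X_0,\dots,X_m$ (together with $0$). For $f\in\mathbb F_q[\mathbf X]^H_v$, $\mathrm{ev}_{\mathbb P^m}(f)=(f(\mathbf P))_{\mathbf P\in\mathbb P^m}\in\mathbb F_q^{\mathbb P^m}$, every point being evaluated at its standard representative. $\mathrm{Poly}(D)=\langle \mathbf X^{\mathbf d} : \mathbf d\in D\rangle_{\mathbb F_q}$. $\mathrm{PRS}_q(k)=\{\mathrm{ev}_{\mathbb P^1}(g) : g\in\mathbb F_q[S,T]^H_k\}$. $\mathrm{Emb}_{\mathbb P}(m)$ is the set of injective $\mathbb F_q$-linear maps $L:\mathbb F_q^2\to\mathbb F_q^{m+1}$; for homogeneous $f$ of degree $v$, $f\circ L\in\mathbb F_q[S,T]^H_v$ is the bivariate form $f(L(S,T))$. For $m\ge1$, $1\le k\le q-1$, $v=k+(m-1)(q-1)$, $$\mathrm{PLift}_q(m,k)=\{\mathrm{ev}_{\mathbb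 P^m}(f) : f\in\mathbb F_q[\mathbf X]^H_v,\ \forall L\in\mathrm{Emb}_{\mathbb P}(m),\ \mathrm{ev}_{\mathbb P^1}(f\circ L)\in\mathrm{PRS}_q(k)\}.$$ *)

theory Defs
  imports "HOL-Library.Poly_Mapping" "HOL-Library.FuncSet" "HOL-Library.Cardinality"
    "Jordan_Normal_Form.Matrix"
begin

section \<open>Polynomials\<close>

text \<open>A polynomial over a field is a finitely supported map from exponents to coefficients, and an
  exponent is a finitely supported map from variable indices to degrees.\<close>

type_synonym exponent = "nat \<Rightarrow>\<^sub>0 nat"
type_synonym 'a poly_ring = "exponent \<Rightarrow>\<^sub>0 'a"

definition const_poly :: "'a::zero \<Rightarrow> 'a poly_ring" where
  "const_poly c = Poly_Mapping.single 0 c"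

definition var_poly :: "nat \<Rightarrow> 'a::zero_neq_one poly_ring" where
  "var_poly i = Poly_Mapping.single (Poly_Mapping.single i 1) 1"

definition monomial :: "exponent \<Rightarrow> 'a::zero_neq_one poly_ring" where
  "monomial d = Poly_Mapping.single d 1"

text \<open>\<open>eval_poly \<phi> x f\<close> substitutes \<open>x i\<close> for the \<open>i\<close>-th variable, the coefficients being mapped
  to the target ring by \<open>\<phi>\<close>.\<close>

definition eval_poly ::
    "('a::zero \<Rightarrow> 'b::comm_ring_1) \<Rightarrow> (nat \<Rightarrow> 'b) \<Rightarrow> 'a poly_ring \<Rightarrow> 'b" where
  "eval_poly \<phi> x f =
     (\<Sum>d\<in>Poly_Mapping.keys f. \<phi> (Poly_Mapping.lookup f d) *
        (\<Prod>i\<in>Poly_Mapping.keys d. x i ^ Poly_Mapping.lookup d i))"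

definition scale_poly :: "'a::comm_ring_1 \<Rightarrow> 'a poly_ring \<Rightarrow> 'a poly_ring" where
  "scale_poly c f = const_poly c * f"

interpretation poly_space: vector_space "scale_poly :: 'a::field \<Rightarrow> _"
  by unfold_locales
    (simp_all add: scale_poly_def const_poly_def distrib_left distrib_right single_add
      mult_single flip: mult.assoc)

definition exponents :: "nat \<Rightarrow> nat \<Rightarrow> exponent set" where
  "exponents m v =
     {d. Poly_Mapping.keys d \<subseteq> {0..m} \<and> (\<Sum>i=0..m. Poly_Mapping.lookup d i) = v}"

text \<open>The forms of degree \<open>v\<close> in the variables \<open>0, \<dots>, m\<close>, including the zero polynomial.\<close>

definition forms :: "nat \<Rightarrow> nat \<Rightarrow> 'a::zero poly_ring set" where
  "forms m v = {f. Poly_Mapping.keys f \<subseteq> exponents m v}"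

definition Poly :: "exponent set \<Rightarrow> 'a::field poly_ring set" where
  "Poly D = poly_space.span (monomial ` D)"

section \<open>Projective space\<close>

definition proj_rel :: "nat \<Rightarrow> ('a::field vec \<times> 'a vec) set" where
  "proj_rel m =
     {(x, y). x \<in> carrier_vec (m + 1) - {0\<^sub>v (m + 1)} \<and>
              y \<in> carrier_vec (m + 1) - {0\<^sub>v (m + 1)} \<and> (\<exists>c. c \<noteq> 0 \<and> y = c \<cdot>\<^sub>v x)}"

definition proj_space :: "nat \<Rightarrow> 'a::field vec set set" where
  "proj_space m = (carrier_vec (m + 1) - {0\<^sub>v (m + 1)}) // proj_rel m"

definition is_standard :: "'a::field vec \<Rightarrow> bool" where
  "is_standard x \<longleftrightarrow> (\<exists>i<dim_vec x. x $ i = 1 \<and> (\<forall>j<i. x $ j = 0))"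

definition std_rep :: "'a::field vec set \<Rightarrow> 'a vec" where
  "std_rep P = (THE x. x \<in> P \<and> is_standard x)"

lemma std_rep_ex1:
  fixes P :: "'a::field vec set"
  assumes "P \<in> proj_space m"
  shows "\<exists>!x. x \<in> P \<and> is_standard x"
proof -
  let ?V = "carrier_vec (m + 1) - {0\<^sub>v (m + 1)} :: 'a vec set"
  obtain y where y: "y \<in> ?V" and P: "P = proj_rel m `` {y}"
    using assms unfolding proj_space_def by (auto elim: quotientE)
  have dim: "dim_vec y = m + 1"
    using y by auto
  have "\<exists>i<m+1. y $ i \<noteq> 0"
  proof (rule ccontr)
    assume "\<not> ?thesis"
    then have "y = 0\<^sub>v (m + 1)"
      using dim by (intro eq_vecI) auto
    then show False using y by simp
  qed
  define i where "i = (LEAST i. i < m + 1 \<and> y $ i \<noteq> 0)"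
  have i: "i < m + 1" "y $ i \<noteq> 0"
    using LeastI_ex[OF \<open>\<exists>i<m+1. y $ i \<noteq> 0\<close>] unfolding i_def by auto
  have least: "y $ j = 0" if "j < i" for j
    using not_less_Least[of j "\<lambda>i. i < m + 1 \<and> y $ i \<noteq> 0"] that i(1) unfolding i_def by auto
  show ?thesis
  proof (rule ex1I)
    let ?x = "inverse (y $ i) \<cdot>\<^sub>v y"
    have std: "?x $ i = 1" "\<forall>j<i. ?x $ j = 0"
      using i least dim by auto
    then have "?x \<noteq> 0\<^sub>v (m + 1)"
      using i(1) by (metis index_zero_vec(1) zero_neq_one)
    moreover have "?x \<in> carrier_vec (m + 1)"
      using y by auto
    moreover have "inverse (y $ i) \<noteq> 0"
      using i(2) by simp
    ultimately have "?x \<in> P"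
      using y unfolding P proj_rel_def by blast
    moreover have "is_standard ?x"
      using std i(1) dim unfolding is_standard_def by auto
    ultimately show "?x \<in> P \<and> is_standard ?x" ..
  next
    fix x assume x: "x \<in> P \<and> is_standard x"
    then obtain c where c: "c \<noteq> 0" "x = c \<cdot>\<^sub>v y"
      unfolding P proj_rel_def by auto
    obtain l where l: "l < m + 1" "x $ l = 1" "\<forall>j<l. x $ j = 0"
      using x dim c unfolding is_standard_def by auto
    have "y $ l \<noteq> 0" "\<forall>j<l. y $ j = 0"
      using l c dim by auto
    then have "l = i"
      using i least by (metis linorder_neqE_nat)
    then have "c = inverse (y $ i)"
      using l c dim i by (simp add: field_simps)
    then show "x = inverse (y $ i) \<cdot>\<^sub>v y"
      using c by simp
  qed
qed

definition ev :: "nat \<Rightarrow> 'a::field poly_ring \<Rightarrow> 'a vec set \<Rightarrow> 'a" where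
  "ev m f = (\<lambda>P\<in>proj_space m. eval_poly (\<lambda>c. c) (\<lambda>i. std_rep P $ i) f)"

section \<open>Codes\<close>

definition PRS :: "nat \<Rightarrow> ('a::field vec set \<Rightarrow> 'a) set" where
  "PRS k = {ev 1 g | g. g \<in> forms 1 k}"

definition Emb :: "nat \<Rightarrow> ('a::field vec \<Rightarrow> 'a vec) set" where
  "Emb m =
     {L. L \<in> carrier_vec 2 \<rightarrow> carrier_vec (m + 1) \<and>
         (\<forall>x\<in>carrier_vec 2. \<forall>y\<in>carrier_vec 2. L (x + y) = L x + L y) \<and>
         (\<forall>c. \<forall>x\<in>carrier_vec 2. L (c \<cdot>\<^sub>v x) = c \<cdot>\<^sub>v L x) \<and>
         inj_on L (carrier_vec 2)}"

text \<open>The bivariate polynomial \<open>f(L(S,T))\<close>, where \<open>S\<close> and \<open>T\<close> are the variables \<open>0\<close> and \<open>1\<close>: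
  by linearity, the \<open>i\<close>-th coordinate of \<open>L(S,T)\<close> is \<open>L(e\<^sub>0)\<^sub>i S + L(e\<^sub>1)\<^sub>i T\<close>.\<close>

definition compose_lin :: "'a::field poly_ring \<Rightarrow> ('a vec \<Rightarrow> 'a vec) \<Rightarrow> 'a poly_ring" where
  "compose_lin f L =
     eval_poly const_poly
       (\<lambda>i. const_poly (L (unit_vec 2 0) $ i) * var_poly 0 +
            const_poly (L (unit_vec 2 1) $ i) * var_poly 1) f"

text \<open>The size \<open>q\<close> of the field is \<open>CARD('a)\<close>; only \<open>m \<ge> 1\<close> is meaningful.\<close>

definition PLift :: "nat \<Rightarrow> nat \<Rightarrow> ('a::{finite,field} vec set \<Rightarrow> 'a) set" where
  "PLift m k =
     {ev m f | f. f \<in> forms m (k + (m - 1) * (CARD('a) - 1)) \<and>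
                  (\<forall>L\<in>Emb m. ev 1 (compose_lin f L) \<in> PRS k)}"

end

theory Submission
  imports "HOL-Computational_Algebra.Polynomial" Defs
begin

text \<open>The lifting condition on a form \<open>f\<close> depends only on the function of \<open>f\<close>, and it persists when
  the linear embeddings are replaced by arbitrary linear maps, since \<open>v \<equiv> k\<close> modulo \<open>q - 1\<close>.
  Hence it is stable under all diagonal substitutions, zero entries allowed. On each coordinate the
  functions \<open>x\<^sup>i\<close>, \<open>0 \<le> i < q\<close>, are linearly independent characters of the multiplicative monoid of
  the field, so linear combinations of diagonal substitutions separate the monomials of \<open>f\<close>
  that differ as functions, and each of these again satisfies the lifting condition.\<close>

section \<open>Evaluation of polynomials\<close>

abbreviation eval_at :: "(nat \<Rightarrow> 'a) \<Rightarrow> 'a::field poly_ring \<Rightarrow> 'a" where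
  "eval_at \<equiv> eval_poly (\<lambda>c. c)"

definition monomial_value :: "(nat \<Rightarrow> 'a::comm_ring_1) \<Rightarrow> exponent \<Rightarrow> 'a" where
  "monomial_value x d = (\<Prod>i\<in>Poly_Mapping.keys d. x i ^ Poly_Mapping.lookup d i)"

text \<open>Indices outside the support contribute \<open>x i ^ 0 = 1\<close>, even where
  \<open>x i = 0\<close>, so different exponents can be compared over one common index set.\<close>

lemma monomial_value_superset:
  assumes "finite S" "Poly_Mapping.keys d \<subseteq> S"
  shows "monomial_value x d = (\<Prod>i\<in>S. x i ^ Poly_Mapping.lookup d i)"
  unfolding monomial_value_def using assms
  by (intro prod.mono_neutral_left) (auto simp: in_keys_iff)

lemma monomial_value_zero [simp]: "monomial_value x 0 = 1"
  by (simp add: monomial_value_def)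

lemma monomial_value_single [simp]: "monomial_value x (Poly_Mapping.single i n) = x i ^ n"
  by (subst monomial_value_superset[of "{i}"]) auto

lemma monomial_value_add:
  "monomial_value x (d + e) = monomial_value x d * monomial_value x e"
proof -
  let ?S = "Poly_Mapping.keys d \<union> Poly_Mapping.keys e"
  have "Poly_Mapping.keys (d + e) \<subseteq> ?S" by (rule keys_add)
  then show ?thesis
    by (simp add: monomial_value_superset[of ?S] lookup_add power_add prod.distrib)
qed

lemma eval_poly_eq_sum:
  "eval_poly \<phi> x f =
     (\<Sum>d\<in>Poly_Mapping.keys f. \<phi> (Poly_Mapping.lookup f d) * monomial_value x d)"
  by (simp add: eval_poly_def monomial_value_def)

lemma eval_at_superset:
  assumes "finite S" "Poly_Mapping.keys f \<subseteq> S"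
  shows "eval_at x f = (\<Sum>d\<in>S. Poly_Mapping.lookup f d * monomial_value x d)"
  unfolding eval_poly_eq_sum using assms
  by (intro sum.mono_neutral_left) (auto simp: in_keys_iff)

lemma eval_at_zero [simp]: "eval_at x 0 = 0"
  by (simp add: eval_poly_def)

lemma eval_at_add: "eval_at x (f + g) = eval_at x f + eval_at x g"
proof -
  let ?S = "Poly_Mapping.keys f \<union> Poly_Mapping.keys g"
  have "Poly_Mapping.keys (f + g) \<subseteq> ?S" by (rule keys_add)
  then show ?thesis
    by (simp add: eval_at_superset[of ?S] lookup_add sum.distrib distrib_right)
qed

lemma eval_at_sum: "eval_at x (\<Sum>i\<in>I. f i) = (\<Sum>i\<in>I. eval_at x (f i))"
  by (induction I rule: infinite_finite_induct) (auto simp: eval_at_add)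

lemma eval_at_single [simp]:
  "eval_at x (Poly_Mapping.single d c) = c * monomial_value x d"
  by (subst eval_at_superset[of "{d}"]) auto

lemma poly_ring_eq_sum_single:
  fixes f :: "'a::comm_monoid_add poly_ring"
  shows "f = (\<Sum>d\<in>Poly_Mapping.keys f. Poly_Mapping.single d (Poly_Mapping.lookup f d))"
  by (rule poly_mapping_eqI)
    (auto simp: lookup_sum lookup_single when_def in_keys_iff sum.delta)

lemma eval_at_mult: "eval_at x (f * g) = eval_at x f * eval_at x g"
proof -
  have "eval_at x (f * g) =
      eval_at x ((\<Sum>d\<in>Poly_Mapping.keys f. Poly_Mapping.single d (Poly_Mapping.lookup f d)) *
                 (\<Sum>e\<in>Poly_Mapping.keys g. Poly_Mapping.single e (Poly_Mapping.lookup g e)))"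
    using poly_ring_eq_sum_single[of f] poly_ring_eq_sum_single[of g] by simp
  also have "\<dots> = eval_at x f * eval_at x g"
    unfolding sum_product eval_at_sum mult_single eval_at_single monomial_value_add
    unfolding eval_poly_eq_sum sum_product by (simp add: mult_ac)
  finally show ?thesis .
qed

lemma eval_at_const [simp]: "eval_at x (const_poly c) = c"
  by (simp add: const_poly_def)

lemma eval_at_var [simp]: "eval_at x (var_poly i) = x i"
  by (simp add: var_poly_def)

lemma eval_at_monomial [simp]: "eval_at x (monomial d) = monomial_value x d"
  by (simp add: monomial_def)

lemma eval_at_scale [simp]: "eval_at x (scale_poly c f) = c * eval_at x f"
  by (simp add: scale_poly_def eval_at_mult)

lemma eval_at_power: "eval_at x (f ^ n) = eval_at x f ^ n"
  by (induction n) (auto simp: eval_at_mult simp flip: single_one const_poly_def)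

lemma eval_at_prod: "eval_at x (\<Prod>i\<in>I. f i) = (\<Prod>i\<in>I. eval_at x (f i))"
  by (induction I rule: infinite_finite_induct)
    (auto simp: eval_at_mult simp flip: single_one const_poly_def)

text \<open>\<open>compose_lin\<close> is itself a substitution into a polynomial ring, and
  evaluation at \<open>y\<close> is a ring homomorphism fixing the constants, so the two
  substitutions merge into one.\<close>

lemma eval_at_compose_lin:
  "eval_at y (compose_lin f L) =
     eval_at (\<lambda>i. L (unit_vec 2 0) $ i * y 0 + L (unit_vec 2 1) $ i * y 1) f"
  unfolding compose_lin_def eval_poly_def[of const_poly] eval_at_sum eval_at_mult eval_at_prod
    eval_at_power eval_at_add eval_at_const eval_at_var
  by (simp add: eval_poly_def)

section \<open>Forms as homogeneous functions\<close>

lemma monomial_value_exponents: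
  assumes "d \<in> exponents m v"
  shows "monomial_value x d = (\<Prod>i=0..m. x i ^ Poly_Mapping.lookup d i)"
  using assms by (intro monomial_value_superset) (auto simp: exponents_def)

lemma eval_at_forms_cong:
  assumes "f \<in> forms m v" "\<And>i. i \<le> m \<Longrightarrow> x i = y i"
  shows "eval_at x f = eval_at y f"
  unfolding eval_poly_eq_sum
proof (intro sum.cong refl)
  fix d assume "d \<in> Poly_Mapping.keys f"
  then have "d \<in> exponents m v" using assms(1) by (auto simp: forms_def)
  then show "Poly_Mapping.lookup f d * monomial_value x d =
      Poly_Mapping.lookup f d * monomial_value y d"
    using assms(2) by (simp add: monomial_value_exponents)
qed

text \<open>Each monomial of total degree \<open>v\<close> picks up the factor \<open>c ^ v\<close>.
  The case \<open>c = 0\<close> is included and later gives the value at the origin.\<close>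

lemma eval_at_forms_scale:
  assumes "f \<in> forms m v"
  shows "eval_at (\<lambda>i. c * x i) f = c ^ v * eval_at x f"
  unfolding eval_poly_eq_sum sum_distrib_left
proof (intro sum.cong refl)
  fix d assume "d \<in> Poly_Mapping.keys f"
  then have d: "d \<in> exponents m v" using assms(1) by (auto simp: forms_def)
  then have "(\<Prod>i=0..m. c ^ Poly_Mapping.lookup d i) = c ^ v"
    by (simp add: exponents_def flip: power_sum)
  then show "Poly_Mapping.lookup f d * monomial_value (\<lambda>i. c * x i) d =
      c ^ v * (Poly_Mapping.lookup f d * monomial_value x d)"
    using d by (simp add: monomial_value_exponents power_mult_distrib prod.distrib)
qed

lemma forms_zero: "0 \<in> forms m v"
  by (simp add: forms_def)

lemma forms_add: "f \<in> forms m v \<Longrightarrow> g \<in> forms m v \<Longrightarrow> f + g \<in> forms m v"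
  using keys_add[of f g] by (auto simp: forms_def)

lemma forms_sum: "(\<And>i. i \<in> I \<Longrightarrow> f i \<in> forms m v) \<Longrightarrow> (\<Sum>i\<in>I. f i) \<in> forms m v"
  by (induction I rule: infinite_finite_induct) (auto simp: forms_zero forms_add)

lemma forms_single: "d \<in> exponents m v \<Longrightarrow> Poly_Mapping.single d c \<in> forms m v"
  by (auto simp: forms_def)

lemma forms_scale:
  assumes "f \<in> forms m v" shows "scale_poly c f \<in> forms m v"
  using keys_mult[of "const_poly c" f] assms
  by (auto simp: forms_def scale_poly_def const_poly_def split: if_splits)

section \<open>Binary forms as coefficient sequences\<close>

lemma exponents_1: "exponents 1 k =
    (\<lambda>j. Poly_Mapping.single 0 j + Poly_Mapping.single 1 (k - j)) ` {..k}" (is "_ = ?e ` _")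
proof (intro equalityI subsetI)
  fix d assume d: "d \<in> exponents 1 k"
  then have le: "Poly_Mapping.lookup d 0 + Poly_Mapping.lookup d 1 = k"
    and keys: "Poly_Mapping.keys d \<subseteq> {0, 1}"
    by (auto simp: exponents_def)
  have "d = ?e (Poly_Mapping.lookup d 0)"
    using keys le by (intro poly_mapping_eqI)
      (auto simp: lookup_add lookup_single when_def in_keys_iff subset_iff)
  with le show "d \<in> ?e ` {..k}" by auto
next
  fix d assume "d \<in> ?e ` {..k}"
  then show "d \<in> exponents 1 k"
    using keys_add by (fastforce simp: exponents_def lookup_add lookup_single split: if_splits)
qed

text \<open>With its converse \<open>forms_1_of_coeffs\<close>, this trades binary forms for
  sequences indexed by the degree in the variable 0; one sequence serves all
  \<open>y\<close>.\<close>

lemma eval_at_forms_1: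
  assumes "g \<in> forms 1 k"
  shows "\<exists>c. \<forall>y. eval_at y g = (\<Sum>j\<le>k. c j * (y 0 ^ j * y 1 ^ (k - j)))"
proof -
  let ?e = "\<lambda>j. Poly_Mapping.single 0 j + Poly_Mapping.single (1::nat) (k - j)"
  have "inj_on ?e {..k}"
  proof (rule inj_onI)
    fix i j assume "?e i = ?e j"
    then have "Poly_Mapping.lookup (?e i) 0 = Poly_Mapping.lookup (?e j) 0" by simp
    then show "i = j" by (simp add: lookup_add lookup_single)
  qed
  moreover have "eval_at y g = (\<Sum>d\<in>?e ` {..k}. Poly_Mapping.lookup g d * monomial_value y d)" for y
    using assms unfolding forms_def exponents_1 by (intro eval_at_superset) auto
  ultimately have "\<forall>y. eval_at y g = (\<Sum>j\<le>k. Poly_Mapping.lookup g (?e j) * (y 0 ^ j * y 1 ^ (k - j)))"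
    by (simp add: sum.reindex monomial_value_add)
  then show ?thesis by (intro exI[of _ "\<lambda>j. Poly_Mapping.lookup g (?e j)"])
qed

lemma forms_1_of_coeffs:
  "\<exists>g\<in>forms 1 k. \<forall>y. eval_at y g = (\<Sum>j\<le>k. c j * (y 0 ^ j * y 1 ^ (k - j)))"
proof
  let ?e = "\<lambda>j. Poly_Mapping.single 0 j + Poly_Mapping.single (1::nat) (k - j)"
  let ?g = "\<Sum>j\<le>k. Poly_Mapping.single (?e j) (c j)"
  show "\<forall>y. eval_at y ?g = (\<Sum>j\<le>k. c j * (y 0 ^ j * y 1 ^ (k - j)))"
    by (simp add: eval_at_sum monomial_value_add)
  show "?g \<in> forms 1 k"
    by (intro forms_sum forms_single) (unfold exponents_1, blast)
qed

section \<open>Powers in a finite field\<close>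

text \<open>Multiplication by \<open>x\<close> permutes the nonzero elements; comparing their
  product before and after and cancelling it leaves the claim.\<close>

lemma power_card_minus_1:
  fixes x :: "'a::{finite,field}"
  assumes "x \<noteq> 0"
  shows "x ^ (CARD('a) - 1) = 1"
proof -
  let ?U = "UNIV - {0 :: 'a}"
  have "bij_betw ((*) x) ?U ?U"
    by (rule bij_betwI[where g = "(*) (inverse x)"]) (use assms in auto)
  then have "(\<Prod>y\<in>?U. y) = (\<Prod>y\<in>?U. x * y)"
    by (rule prod.reindex_bij_betw[symmetric])
  also have "\<dots> = x ^ (CARD('a) - 1) * (\<Prod>y\<in>?U. y)"
    by (simp add: prod.distrib card_Diff_singleton)
  finally show ?thesis by simp
qed

text \<open>For nonzero \<open>x\<close> the extra factor is a power of 1; for \<open>x = 0\<close>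
  both sides vanish because \<open>n\<close> is positive.\<close>

lemma power_add_card:
  fixes x :: "'a::{finite,field}"
  assumes "0 < n"
  shows "x ^ (n + l * (CARD('a) - 1)) = x ^ n"
proof (cases "x = 0")
  case False
  then have "x ^ (l * (CARD('a) - 1)) = 1"
    by (subst mult.commute, subst power_mult) (simp only: power_card_minus_1 power_one)
  then show ?thesis by (simp add: power_add)
qed (use assms in \<open>simp add: power_0_left\<close>)

text \<open>Positive exponents are reduced into the range from 1 to \<open>q - 1\<close>, so that a
  positive multiple of \<open>q - 1\<close> does not become 0: the functions
  \<open>x ^ (q - 1)\<close> and \<open>x ^ 0\<close> differ at \<open>x = 0\<close>.\<close>

definition reduced_exponent :: "nat \<Rightarrow> nat \<Rightarrow> nat" where
  "reduced_exponent q n = (if n = 0 then 0 else Suc ((n - 1) mod (q - 1)))"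

lemma reduced_exponent_less:
  assumes "2 \<le> q"
  shows "reduced_exponent q n < q"
proof -
  have "(n - 1) mod (q - 1) < q - 1"
    using assms by (intro mod_less_divisor) simp
  then have "Suc ((n - 1) mod (q - 1)) < q" by linarith
  then show ?thesis using assms by (simp only: reduced_exponent_def split: if_split) simp
qed

lemma power_reduced_exponent:
  fixes x :: "'a::{finite,field}"
  shows "x ^ reduced_exponent CARD('a) n = x ^ n"
proof (cases "n = 0")
  case False
  let ?q = "CARD('a) - 1"
  have "n = Suc ((n - 1) mod ?q) + ((n - 1) div ?q) * ?q"
    using False mod_mult_div_eq[of "n - 1" ?q] by (simp only: mult.commute) linarith
  then show ?thesis
    using False power_add_card[of "Suc ((n - 1) mod ?q)" x "(n - 1) div ?q"]
    by (simp add: reduced_exponent_def)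
qed (simp add: reduced_exponent_def)

lemma two_le_card_field: "2 \<le> CARD('a::{finite,field})"
  using card_mono[of "UNIV :: 'a set" "{0, 1}"] by simp

text \<open>The weights are the coefficients of the Lagrange basis polynomials.\<close>

lemma coefficient_weights:
  "\<exists>c :: nat \<Rightarrow> 'a::{finite,field} \<Rightarrow> 'a.
     \<forall>i<CARD('a). \<forall>j. (\<Sum>a\<in>UNIV. c j a * a ^ i) = of_bool (i = j)"
proof -
  define l :: "'a \<Rightarrow> 'a poly" where
    "l a = Polynomial.smult (inverse (\<Prod>b\<in>UNIV - {a}. a - b)) (\<Prod>b\<in>UNIV - {a}. [:- b, 1:])" for a
  have poly_l: "poly (l a) x = of_bool (a = x)" for a x
    by (auto simp: l_def poly_prod)
  have degree_l: "Polynomial.degree (l a) < CARD('a)" for a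
  proof -
    have "Polynomial.degree (\<Prod>b\<in>UNIV - {a}. [:- b, 1:]) \<le> (\<Sum>b\<in>UNIV - {a}. Polynomial.degree [:- b, 1:])"
      using degree_prod_sum_le[of "UNIV - {a}" "\<lambda>b. [:- b, 1:]"] by (simp add: o_def)
    then have "Polynomial.degree (l a) \<le> CARD('a) - 1"
      unfolding l_def using degree_smult_le order_trans by (force simp: card_Diff_singleton)
    then show ?thesis using two_le_card_field[where 'a='a] by linarith
  qed
  \<comment> \<open>Both sides have degree below the field size and agree at every field element, so
    interpolation reproduces the power exactly. Comparing j-th coefficients then gives the required
    relation.\<close>
  have expansion: "(\<Sum>a\<in>UNIV. Polynomial.smult (a ^ i) (l a)) = Polynomial.monom 1 i" if "i < CARD('a)" for i
  proof (rule poly_eqI_degree[of UNIV])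
    fix x show "poly (\<Sum>a\<in>UNIV. Polynomial.smult (a ^ i) (l a)) x = poly (Polynomial.monom 1 i) x"
      by (simp add: poly_sum poly_l poly_monom)
  next
    have "Polynomial.degree (\<Sum>a\<in>UNIV. Polynomial.smult (a ^ i) (l a)) \<le> CARD('a) - 1"
      using degree_l by (intro degree_sum_le) (auto intro: order_trans[OF degree_smult_le] simp: less_eq_Suc_le le_diff_conv2)
    then show "Polynomial.degree (\<Sum>a\<in>UNIV. Polynomial.smult (a ^ i) (l a)) < card (UNIV :: 'a set)"
      using two_le_card_field[where 'a='a] by linarith
  qed (use that in \<open>simp add: degree_monom_eq\<close>)
  have "(\<Sum>a\<in>UNIV. poly.coeff (l a) j * a ^ i) = of_bool (i = j)" if "i < CARD('a)" for i j
  proof -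
    have "(\<Sum>a\<in>UNIV. poly.coeff (l a) j * a ^ i) = poly.coeff (\<Sum>a\<in>UNIV. Polynomial.smult (a ^ i) (l a)) j"
      by (simp add: coeff_sum mult.commute)
    then show ?thesis
      using expansion[OF that] by simp
  qed
  then show ?thesis
    by (intro exI[of _ "\<lambda>j a. poly.coeff (l a) j"]) blast
qed

section \<open>Restriction to planes\<close>

text \<open>The lifting condition as a condition on functions. The vectors \<open>a\<close> and \<open>b\<close> need not be
  independent, which makes the condition stable under every diagonal substitution, including
  those that set coordinates to zero.\<close>

definition restricts_to_forms :: "nat \<Rightarrow> ((nat \<Rightarrow> 'a::field) \<Rightarrow> 'a) \<Rightarrow> bool" where
  "restricts_to_forms k F \<longleftrightarrow>
     (\<forall>a b. \<exists>c. \<forall>s t. F (\<lambda>i. a i * s + b i * t) = (\<Sum>j\<le>k. c j * (s ^ j * t ^ (k - j))))"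

text \<open>On a fixed plane the coefficient sequences of the summands combine with the same weights
  \<open>u\<close>.\<close>

lemma restricts_to_forms_sum:
  fixes F :: "'e \<Rightarrow> (nat \<Rightarrow> 'a::field) \<Rightarrow> 'a"
  assumes "\<And>e. e \<in> E \<Longrightarrow> restricts_to_forms k (F e)"
  shows "restricts_to_forms k (\<lambda>x. \<Sum>e\<in>E. u e * F e x)"
  unfolding restricts_to_forms_def
proof (intro allI)
  fix a b :: "nat \<Rightarrow> 'a"
  have "\<forall>e\<in>E. \<exists>c. \<forall>s t. F e (\<lambda>i. a i * s + b i * t) = (\<Sum>j\<le>k. c j * (s ^ j * t ^ (k - j)))"
    using assms by (simp add: restricts_to_forms_def)
  then obtain c where c: "\<And>e s t. e \<in> E \<Longrightarrow>
      F e (\<lambda>i. a i * s + b i * t) = (\<Sum>j\<le>k. c e j * (s ^ j * t ^ (k - j)))"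
    by metis
  have "(\<Sum>e\<in>E. u e * F e (\<lambda>i. a i * s + b i * t)) =
      (\<Sum>j\<le>k. (\<Sum>e\<in>E. u e * c e j) * (s ^ j * t ^ (k - j)))" for s t
  proof -
    have "(\<Sum>e\<in>E. u e * F e (\<lambda>i. a i * s + b i * t)) =
        (\<Sum>e\<in>E. \<Sum>j\<le>k. u e * c e j * (s ^ j * t ^ (k - j)))"
      by (intro sum.cong refl) (simp add: c sum_distrib_left mult.assoc)
    also have "\<dots> = (\<Sum>j\<le>k. \<Sum>e\<in>E. u e * c e j * (s ^ j * t ^ (k - j)))"
      by (rule sum.swap)
    finally show ?thesis by (simp add: sum_distrib_right)
  qed
  then show "\<exists>c. \<forall>s t. (\<Sum>e\<in>E. u e * F e (\<lambda>i. a i * s + b i * t)) =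
      (\<Sum>j\<le>k. c j * (s ^ j * t ^ (k - j)))"
    by (intro exI[of _ "\<lambda>j. \<Sum>e\<in>E. u e * c e j"]) simp
qed

lemma restricts_to_forms_add:
  assumes "restricts_to_forms k F" "restricts_to_forms k G"
  shows "restricts_to_forms k (\<lambda>x. F x + G x)"
  using restricts_to_forms_sum[of "UNIV :: bool set" k "\<lambda>e. if e then F else G" "\<lambda>_. 1"] assms
  by (simp add: UNIV_bool add.commute)

lemma restricts_to_forms_cmult:
  "restricts_to_forms k F \<Longrightarrow> restricts_to_forms k (\<lambda>x. u * F x)"
  using restricts_to_forms_sum[of "{()}" k "\<lambda>_. F" "\<lambda>_. u"] by simp

text \<open>The scaling by \<open>e\<close> is absorbed into the two spanning vectors, which may
  become dependent or zero.\<close>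

lemma restricts_to_forms_diagonal:
  fixes F :: "(nat \<Rightarrow> 'a::field) \<Rightarrow> 'a"
  assumes "restricts_to_forms k F"
  shows "restricts_to_forms k (\<lambda>x. F (\<lambda>i. e i * x i))"
  unfolding restricts_to_forms_def
proof (intro allI)
  fix a b :: "nat \<Rightarrow> 'a"
  show "\<exists>c. \<forall>s t. F (\<lambda>i. e i * (a i * s + b i * t)) = (\<Sum>j\<le>k. c j * (s ^ j * t ^ (k - j)))"
    using assms[unfolded restricts_to_forms_def, rule_format, of "\<lambda>i. e i * a i" "\<lambda>i. e i * b i"]
    by (simp add: algebra_simps)
qed

section \<open>Passage between codewords and functions\<close>

lemma std_rep_of_point:
  fixes w :: "'a::field vec"
  assumes "w \<in> carrier_vec (m + 1)" "w \<noteq> 0\<^sub>v (m + 1)"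
  obtains P c where "P \<in> proj_space m" "c \<noteq> 0" "std_rep P = c \<cdot>\<^sub>v w"
proof -
  let ?P = "proj_rel m `` {w}"
  have P: "?P \<in> proj_space m"
    unfolding proj_space_def using assms by (intro quotientI) simp
  then have "std_rep ?P \<in> ?P"
    using theI'[OF std_rep_ex1[OF P]] by (simp add: std_rep_def)
  then obtain c where "c \<noteq> 0" "std_rep ?P = c \<cdot>\<^sub>v w"
    by (auto simp: proj_rel_def)
  with P that show ?thesis by blast
qed

lemma ev_eqI:
  assumes "\<And>P. P \<in> proj_space m \<Longrightarrow>
    eval_at (\<lambda>i. std_rep P $ i) f = eval_at (\<lambda>i. std_rep P $ i) g"
  shows "ev m f = ev m g"
  using assms by (auto simp: ev_def restrict_def)

lemma ev_eqD:
  assumes "ev m f = ev m g" "P \<in> proj_space m"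
  shows "eval_at (\<lambda>i. std_rep P $ i) f = eval_at (\<lambda>i. std_rep P $ i) g"
  using fun_cong[OF assms(1), of P] assms(2) by (simp add: ev_def)

text \<open>The two columns of \<open>L\<close> serve as \<open>a\<close> and \<open>b\<close>; the
  resulting binary form agrees with \<open>compose_lin f L\<close> at every pair, in particular at
  the standard representatives.\<close>

lemma compose_lin_PRS_if_restricts_to_forms:
  assumes "restricts_to_forms k (\<lambda>x. eval_at x f)"
  shows "ev 1 (compose_lin f L) \<in> PRS k"
proof -
  obtain c where c: "\<And>s t. eval_at (\<lambda>i. L (unit_vec 2 0) $ i * s + L (unit_vec 2 1) $ i * t) f =
      (\<Sum>j\<le>k. c j * (s ^ j * t ^ (k - j)))"
    using assms[unfolded restricts_to_forms_def, rule_format,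
        of "\<lambda>i. L (unit_vec 2 0) $ i" "\<lambda>i. L (unit_vec 2 1) $ i"] by blast
  obtain g where g: "g \<in> forms 1 k" "\<And>y. eval_at y g = (\<Sum>j\<le>k. c j * (y 0 ^ j * y 1 ^ (k - j)))"
    using forms_1_of_coeffs by metis
  have "ev 1 (compose_lin f L) = ev 1 g"
    by (intro ev_eqI) (simp only: eval_at_compose_lin c g(2))
  with g(1) show ?thesis unfolding PRS_def by blast
qed

text \<open>On a degenerate plane, spanned by a single vector, the restriction is a multiple of the
  \<open>v\<close>-th power of a linear form, which agrees with its \<open>k\<close>-th power.\<close>

lemma restricts_to_form_degenerate:
  fixes f :: "'a::field poly_ring"
  assumes f: "f \<in> forms m v" and vk: "\<And>x::'a. x ^ v = x ^ k"
    and w: "\<And>i. i \<le> m \<Longrightarrow> a i = \<alpha> * w i" "\<And>i. i \<le> m \<Longrightarrow> b i = \<beta> * w i"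
  shows "\<exists>c. \<forall>s t. eval_at (\<lambda>i. a i * s + b i * t) f = (\<Sum>j\<le>k. c j * (s ^ j * t ^ (k - j)))"
proof (intro exI allI)
  fix s t
  have "eval_at (\<lambda>i. a i * s + b i * t) f = eval_at (\<lambda>i. (\<alpha> * s + \<beta> * t) * w i) f"
    by (rule eval_at_forms_cong[OF f]) (simp add: w algebra_simps)
  also have "\<dots> = (\<alpha> * s + \<beta> * t) ^ k * eval_at w f"
    by (simp add: eval_at_forms_scale[OF f] vk)
  \<comment> \<open>The binomial theorem supplies the coefficients, free of \<open>s\<close> and
    \<open>t\<close>, for the witness left open at the start.\<close>
  also have "\<dots> = (\<Sum>j\<le>k. (of_nat (k choose j) * \<alpha> ^ j * \<beta> ^ (k - j) * eval_at w f) *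
      (s ^ j * t ^ (k - j)))"
    unfolding binomial_ring sum_distrib_right by (simp add: power_mult_distrib mult_ac)
  finally show "eval_at (\<lambda>i. a i * s + b i * t) f = (\<Sum>j\<le>k.
      (of_nat (k choose j) * \<alpha> ^ j * \<beta> ^ (k - j) * eval_at w f) * (s ^ j * t ^ (k - j)))" .
qed

text \<open>Independent \<open>a\<close> and \<open>b\<close> are the columns of an embedding, for
  which the hypothesis supplies a binary form; dependent ones fall under the degenerate
  case.\<close>

lemma restricts_to_forms_if_compose_lin_PRS:
  fixes f :: "'a::field poly_ring"
  assumes f: "f \<in> forms m v" and vk: "\<And>x::'a. x ^ v = x ^ k" and k: "1 \<le> k"
    and PRS: "\<And>L. L \<in> Emb m \<Longrightarrow> ev 1 (compose_lin f L) \<in> PRS k"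
  shows "restricts_to_forms k (\<lambda>x. eval_at x f)"
  unfolding restricts_to_forms_def
proof (intro allI)
  fix a b :: "nat \<Rightarrow> 'a"
  show "\<exists>c. \<forall>s t. eval_at (\<lambda>i. a i * s + b i * t) f = (\<Sum>j\<le>k. c j * (s ^ j * t ^ (k - j)))"
  \<comment> \<open>Dependence is tested on the coordinates up to \<open>m\<close> only, the ones
    that \<open>f\<close> sees.\<close>
  proof (cases "\<exists>\<alpha> \<beta>. (\<alpha> \<noteq> 0 \<or> \<beta> \<noteq> 0) \<and> (\<forall>i\<le>m. a i * \<alpha> + b i * \<beta> = 0)")
    case True
    then obtain \<alpha> \<beta> where ne: "\<alpha> \<noteq> 0 \<or> \<beta> \<noteq> 0" and dep: "\<And>i. i \<le> m \<Longrightarrow> a i * \<alpha> + b i * \<beta> = 0"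
      by blast
    show ?thesis
    proof (cases "\<beta> = 0")
      case True
      then have "a i = 0 * b i" if "i \<le> m" for i
        using dep[OF that] ne by simp
      then show ?thesis
        by (intro restricts_to_form_degenerate[OF f vk, of a 0 b b 1]) simp_all
    next
      case False
      then have "b i = (- \<alpha> / \<beta>) * a i" if "i \<le> m" for i
        using dep[OF that] by (simp add: field_simps add_eq_0_iff)
      then show ?thesis
        by (intro restricts_to_form_degenerate[OF f vk, of a 1 a b "- \<alpha> / \<beta>"]) simp_all
    qed
  next
    case False
    then have indep: "\<alpha> = 0 \<and> \<beta> = 0" if "\<And>i. i \<le> m \<Longrightarrow> a i * \<alpha> + b i * \<beta> = 0" for \<alpha> \<beta>
      using that by blast
    define L where "L w = vec (m + 1) (\<lambda>i. a i * w $ 0 + b i * w $ 1)" for w :: "'a vec"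
    have "inj_on L (carrier_vec 2)"
    proof (rule inj_onI)
      fix x y :: "'a vec"
      assume xy: "x \<in> carrier_vec 2" "y \<in> carrier_vec 2" "L x = L y"
      have "a i * (x $ 0 - y $ 0) + b i * (x $ 1 - y $ 1) = 0" if "i \<le> m" for i
      proof -
        have "L x $ i = L y $ i" using xy(3) by simp
        then show ?thesis using that by (simp add: L_def algebra_simps)
      qed
      from indep[OF this] show "x = y"
        using xy(1,2) by (intro eq_vecI) (auto simp: less_2_cases_iff)
    qed
    then have "L \<in> Emb m"
      by (auto simp: Emb_def L_def algebra_simps intro!: eq_vecI)
    from PRS[OF this] obtain g where g: "g \<in> forms 1 k" "ev 1 (compose_lin f L) = ev 1 g"
      unfolding PRS_def by blast
    obtain c where c: "\<And>y. eval_at y g = (\<Sum>j\<le>k. c j * (y 0 ^ j * y 1 ^ (k - j)))"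
      using eval_at_forms_1[OF g(1)] by blast
    have L: "eval_at y (compose_lin f L) = eval_at (\<lambda>i. a i * y 0 + b i * y 1) f" for y
      unfolding eval_at_compose_lin by (rule eval_at_forms_cong[OF f]) (simp add: L_def)
    have "eval_at (\<lambda>i. a i * s + b i * t) f = (\<Sum>j\<le>k. c j * (s ^ j * t ^ (k - j)))" for s t
    \<comment> \<open>The origin is no projective point, so it is treated apart: both sides vanish
      there because \<open>k\<close> is positive.\<close>
    proof (cases "s = 0 \<and> t = 0")
      case True
      have "eval_at (\<lambda>i. a i * s + b i * t) f = eval_at (\<lambda>i. 0 * (a i * s + b i * t)) f"
        using True by simp
      also have "\<dots> = 0 ^ k * eval_at (\<lambda>i. a i * s + b i * t) f"
        unfolding eval_at_forms_scale[OF f] vk ..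
      finally have "eval_at (\<lambda>i. a i * s + b i * t) f = 0"
        using k by (auto simp: power_0_left)
      moreover have "(\<Sum>j\<le>k. c j * (s ^ j * t ^ (k - j))) = 0"
        using True k by (intro sum.neutral) (auto simp: power_0_left)
      ultimately show ?thesis by simp
    next
      case False
      let ?w = "vec 2 (\<lambda>i. if i = 0 then s else t)"
      have "?w \<noteq> 0\<^sub>v (1 + 1)"
      proof
        assume "?w = 0\<^sub>v (1 + 1)"
        then have "?w $ 0 = 0" "?w $ 1 = 0" by simp_all
        with False show False by simp
      qed
      moreover have "?w \<in> carrier_vec (1 + 1)" by simp
      ultimately obtain P u where P: "P \<in> proj_space 1" "u \<noteq> 0" "std_rep P = u \<cdot>\<^sub>v ?w"
        using std_rep_of_point by blast
      then have coords: "std_rep P $ 0 = u * s" "std_rep P $ 1 = u * t" by simp_all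
      \<comment> \<open>The code condition speaks of the standard representative
        \<open>u * (s, t)\<close> only. Both sides scale by \<open>u ^ k\<close>, the left one
        because \<open>u ^ v = u ^ k\<close>, and this nonzero factor cancels.\<close>
      have "u ^ k * eval_at (\<lambda>i. a i * s + b i * t) f =
          eval_at (\<lambda>i. u * (a i * s + b i * t)) f"
        unfolding eval_at_forms_scale[OF f] vk ..
      also have "\<dots> = eval_at (\<lambda>i. std_rep P $ i) (compose_lin f L)"
        unfolding L coords by (simp add: algebra_simps)
      also have "\<dots> = eval_at (\<lambda>i. std_rep P $ i) g"
        by (rule ev_eqD[OF g(2) P(1)])
      also have "\<dots> = (\<Sum>j\<le>k. u ^ k * (c j * (s ^ j * t ^ (k - j))))"
        unfolding c coords
      proof (intro sum.cong refl)
        fix j assume "j \<in> {..k}"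
        then have "u ^ k = u ^ j * u ^ (k - j)" by (simp flip: power_add)
        then show "c j * ((u * s) ^ j * (u * t) ^ (k - j)) = u ^ k * (c j * (s ^ j * t ^ (k - j)))"
          by (simp add: power_mult_distrib mult_ac)
      qed
      also have "\<dots> = u ^ k * (\<Sum>j\<le>k. c j * (s ^ j * t ^ (k - j)))"
        by (simp add: sum_distrib_left)
      finally show ?thesis using P(2) by simp
    qed
    then show ?thesis by blast
  qed
qed

section \<open>Separation of exponent classes\<close>

text \<open>Averaging over all diagonal substitutions with the weights \<open>c\<close> extracts the part of \<open>f\<close> whose
  exponents reduce to a given one.\<close>

lemma restricts_to_forms_exponent_class:
  fixes f :: "'a::{finite,field} poly_ring" and m :: nat
  defines "red \<equiv> \<lambda>d. \<lambda>i\<in>{0..m}. reduced_exponent CARD('a) (Poly_Mapping.lookup d i)"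
  assumes f: "f \<in> forms m v" and lift: "restricts_to_forms k (\<lambda>x. eval_at x f)"
  shows "restricts_to_forms k (\<lambda>x. \<Sum>d | d \<in> Poly_Mapping.keys f \<and> red d = \<delta>.
           Poly_Mapping.lookup f d * monomial_value x d)"
\<comment> \<open>If \<delta> is not a value of \<open>red\<close>, the sum is empty and is obtained
  as 0 times the lift. Otherwise \<delta> is undefined outside \<open>{0..m}\<close>, so agreement
  on these indices means equality with \<open>red d\<close>.\<close>
proof (cases "\<exists>d. red d = \<delta>")
  case False
  then show ?thesis
    using restricts_to_forms_cmult[OF lift, of 0] by simp
next
  case True
  obtain c :: "nat \<Rightarrow> 'a \<Rightarrow> 'a" where
    c: "\<And>i j. i < CARD('a) \<Longrightarrow> (\<Sum>a\<in>UNIV. c j a * a ^ i) = of_bool (i = j)"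
    using coefficient_weights by blast
  have c_power: "(\<Sum>a\<in>UNIV. c j a * a ^ n) = of_bool (reduced_exponent CARD('a) n = j)" for j n
    using c[OF reduced_exponent_less[OF two_le_card_field], of j n]
    by (simp add: power_reduced_exponent)
  let ?E = "{0..m} \<rightarrow>\<^sub>E (UNIV :: 'a set)"
  let ?u = "\<lambda>e. \<Prod>i=0..m. c (\<delta> i) (e i)"
  \<comment> \<open>Weight and monomial are both products over the coordinates, so the sum over all
    \<open>e\<close> factors into one-variable sums, each of them 0 or 1.\<close>
  have indicator: "(\<Sum>e\<in>?E. ?u e * monomial_value e d) = of_bool (red d = \<delta>)"
    if "d \<in> exponents m v" for d
  proof -
    have "(\<Sum>e\<in>?E. ?u e * monomial_value e d) =
        (\<Sum>e\<in>?E. \<Prod>i=0..m. c (\<delta> i) (e i) * e i ^ Poly_Mapping.lookup d i)"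
      using that by (simp add: monomial_value_exponents prod.distrib)
    also have "\<dots> = (\<Prod>i=0..m. \<Sum>a\<in>UNIV. c (\<delta> i) a * a ^ Poly_Mapping.lookup d i)"
      by (rule prod_sum_PiE[symmetric]) simp_all
    also have "\<dots> = of_bool (\<forall>i\<in>{0..m}. reduced_exponent CARD('a) (Poly_Mapping.lookup d i) = \<delta> i)"
      by (simp add: c_power)
    also have "(\<forall>i\<in>{0..m}. reduced_exponent CARD('a) (Poly_Mapping.lookup d i) = \<delta> i) \<longleftrightarrow> red d = \<delta>"
      using True by (auto simp: red_def restrict_def fun_eq_iff, metis)
    finally show ?thesis .
  qed
  have "(\<Sum>e\<in>?E. ?u e * eval_at (\<lambda>i. e i * x i) f) =
      (\<Sum>d | d \<in> Poly_Mapping.keys f \<and> red d = \<delta>. Poly_Mapping.lookup f d * monomial_value x d)" for x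
  proof -
    \<comment> \<open>A monomial at the coordinatewise product of \<open>e\<close> and
      \<open>x\<close> is the product of its values at \<open>e\<close> and at \<open>x\<close>, so
      the sum over \<open>e\<close> becomes the indicator.\<close>
    have "(\<Sum>e\<in>?E. ?u e * eval_at (\<lambda>i. e i * x i) f) =
        (\<Sum>e\<in>?E. \<Sum>d\<in>Poly_Mapping.keys f.
          (Poly_Mapping.lookup f d * monomial_value x d) * (?u e * monomial_value e d))"
      by (simp add: eval_poly_eq_sum sum_distrib_left monomial_value_def power_mult_distrib
          prod.distrib mult_ac)
    also have "\<dots> = (\<Sum>d\<in>Poly_Mapping.keys f.
        (Poly_Mapping.lookup f d * monomial_value x d) * (\<Sum>e\<in>?E. ?u e * monomial_value e d))"
      by (subst sum.swap) (simp add: sum_distrib_left)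
    also have "\<dots> = (\<Sum>d\<in>Poly_Mapping.keys f.
        if red d = \<delta> then Poly_Mapping.lookup f d * monomial_value x d else 0)"
      using f by (intro sum.cong refl) (subst indicator, auto simp: forms_def)
    also have "\<dots> = (\<Sum>d | d \<in> Poly_Mapping.keys f \<and> red d = \<delta>.
        Poly_Mapping.lookup f d * monomial_value x d)"
      by (simp add: sum.If_cases Int_def)
    finally show ?thesis .
  qed
  then show ?thesis
    using restricts_to_forms_sum[of ?E k "\<lambda>e x. eval_at (\<lambda>i. e i * x i) f" ?u,
        OF restricts_to_forms_diagonal[OF lift]] by simp
qed

section \<open>Choice of the monomial set and conclusion\<close>

theorem corollary23:
  fixes q m k v :: nat
  assumes "CARD('a::{finite,field}) = q"
    and "1 \<le> m"
    and "1 \<le> k" and "k \<le> q - 1"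
    and "v = k + (m - 1) * (q - 1)"
  shows "\<exists>D\<subseteq>exponents m v. (PLift m k :: ('a vec set \<Rightarrow> 'a) set) = ev m ` Poly D"
proof -
  \<comment> \<open>\<open>v\<close> and \<open>k\<close> differ by a multiple of
    \<open>q - 1\<close>, and positivity of \<open>k\<close> covers \<open>x = 0\<close>.\<close>
  have vk: "x ^ v = x ^ k" for x :: 'a
    using assms power_add_card[of k x "m - 1"] by simp
  define W :: "'a poly_ring set" where
    "W = {f \<in> forms m v. restricts_to_forms k (\<lambda>x. eval_at x f)}"
  have PLift: "PLift m k = ev m ` W"
  proof -
    have "(\<forall>L\<in>Emb m. ev 1 (compose_lin f L) \<in> PRS k) \<longleftrightarrow> restricts_to_forms k (\<lambda>x. eval_at x f)"
      if "f \<in> forms m v" for f :: "'a poly_ring"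
      using compose_lin_PRS_if_restricts_to_forms
        restricts_to_forms_if_compose_lin_PRS[OF that vk \<open>1 \<le> k\<close>] by blast
    then show ?thesis
      unfolding PLift_def W_def assms(1) assms(5)[symmetric] by blast
  qed
  \<comment> \<open>All monomials of \<open>W\<close> are taken, so \<open>Poly D\<close> lies in
    \<open>W\<close> once \<open>W\<close> is a subspace. The converse inclusion is shown after
    evaluation.\<close>
  define D where "D = {d \<in> exponents m v. monomial d \<in> W}"
  have subspace: "poly_space.subspace W"
  proof (rule poly_space.subspaceI)
    have "restricts_to_forms k (\<lambda>x::nat \<Rightarrow> 'a. 0 :: 'a)"
      using restricts_to_forms_sum[of "{}"] by simp
    then show "0 \<in> W" by (simp add: W_def forms_zero)
  qed (auto simp: W_def forms_add forms_scale eval_at_add restricts_to_forms_add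
      restricts_to_forms_cmult)
  have "Poly D \<subseteq> W"
    unfolding Poly_def by (intro poly_space.span_minimal subspace) (auto simp: D_def)
  moreover have "ev m f \<in> ev m ` Poly D" if "f \<in> W" for f
  proof -
    have f: "f \<in> forms m v" and lift: "restricts_to_forms k (\<lambda>x. eval_at x f)"
      using that by (simp_all add: W_def)
    let ?K = "Poly_Mapping.keys f"
    define red where
      "red d = (\<lambda>i\<in>{0..m}. reduced_exponent CARD('a) (Poly_Mapping.lookup d i))" for d
    \<comment> \<open>The representative is taken from the support of \<open>f\<close>, which keeps
      its total degree equal to \<open>v\<close>; the reduced exponent itself may have smaller
      degree.\<close>
    define r where "r \<delta> = (SOME d. d \<in> ?K \<and> red d = \<delta>)" for \<delta>
    define C where "C \<delta> = (\<Sum>d | d \<in> ?K \<and> red d = \<delta>. Poly_Mapping.lookup f d)" for \<delta>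
    have r: "r \<delta> \<in> ?K" "red (r \<delta>) = \<delta>" if "\<delta> \<in> red ` ?K" for \<delta>
      using someI_ex[of "\<lambda>d. d \<in> ?K \<and> red d = \<delta>"] that unfolding r_def by blast+
    have K: "d \<in> exponents m v" if "d \<in> ?K" for d
      using f that by (auto simp: forms_def)
    have value_eq: "monomial_value x d = monomial_value x e"
      if "d \<in> ?K" "e \<in> ?K" "red d = red e" for x :: "nat \<Rightarrow> 'a" and d e
    proof -
      have "x i ^ Poly_Mapping.lookup d i = x i ^ Poly_Mapping.lookup e i" if "i \<in> {0..m}" for i
      proof -
        have "red d i = red e i" using \<open>red d = red e\<close> by simp
        then have "reduced_exponent CARD('a) (Poly_Mapping.lookup d i) =
            reduced_exponent CARD('a) (Poly_Mapping.lookup e i)"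
          using that by (simp add: red_def)
        then show ?thesis
          using power_reduced_exponent[of "x i" "Poly_Mapping.lookup d i"]
            power_reduced_exponent[of "x i" "Poly_Mapping.lookup e i"] by simp
      qed
      then show ?thesis
        by (simp add: monomial_value_exponents[OF K[OF \<open>d \<in> ?K\<close>]]
            monomial_value_exponents[OF K[OF \<open>e \<in> ?K\<close>]])
    qed
    have part: "(\<Sum>d | d \<in> ?K \<and> red d = \<delta>. Poly_Mapping.lookup f d * monomial_value x d) =
        C \<delta> * monomial_value x (r \<delta>)" if "\<delta> \<in> red ` ?K" for \<delta> and x :: "nat \<Rightarrow> 'a"
      unfolding C_def sum_distrib_right
    proof (intro sum.cong refl)
      fix d assume "d \<in> {d \<in> ?K. red d = \<delta>}"
      then have "monomial_value x d = monomial_value x (r \<delta>)"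
        using r[OF that] by (intro value_eq) simp_all
      then show "Poly_Mapping.lookup f d * monomial_value x d =
          Poly_Mapping.lookup f d * monomial_value x (r \<delta>)" by simp
    qed
    have "scale_poly (C \<delta>) (monomial (r \<delta>)) \<in> Poly D" if \<delta>: "\<delta> \<in> red ` ?K" for \<delta>
    \<comment> \<open>The coefficients of a class may cancel. Then its term is zero and
      \<open>r \<delta>\<close> need not lie in \<open>D\<close>; otherwise dividing by
      \<open>C \<delta>\<close> puts the monomial into \<open>W\<close>.\<close>
    proof (cases "C \<delta> = 0")
      case True
      then show ?thesis by (simp add: Poly_def poly_space.span_zero)
    next
      case False
      have "restricts_to_forms k (\<lambda>x. C \<delta> * monomial_value x (r \<delta>))"
        using restricts_to_forms_exponent_class[OF f lift, of \<delta>, folded red_def]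
        unfolding part[OF \<delta>] .
      from restricts_to_forms_cmult[OF this, of "inverse (C \<delta>)"] False
      have "restricts_to_forms k (\<lambda>x :: nat \<Rightarrow> 'a. monomial_value x (r \<delta>))"
        by (simp flip: mult.assoc)
      then have "r \<delta> \<in> D"
        using K[OF r(1)[OF \<delta>]] by (simp add: D_def W_def) (simp add: monomial_def forms_single)
      then show ?thesis
        unfolding Poly_def by (intro poly_space.span_scale poly_space.span_base) simp
    qed
    then have "(\<Sum>\<delta>\<in>red ` ?K. scale_poly (C \<delta>) (monomial (r \<delta>))) \<in> Poly D"
      unfolding Poly_def by (rule poly_space.span_sum)
    \<comment> \<open>Collapsing each class onto its representative can change the polynomial but
      not its function, hence not the codeword.\<close>
    moreover have "eval_at x f = eval_at x (\<Sum>\<delta>\<in>red ` ?K. scale_poly (C \<delta>) (monomial (r \<delta>)))" for x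
    proof -
      have "eval_at x f = (\<Sum>\<delta>\<in>red ` ?K. \<Sum>d | d \<in> ?K \<and> red d = \<delta>.
          Poly_Mapping.lookup f d * monomial_value x d)"
        unfolding eval_poly_eq_sum by (rule sum.image_gen) simp
      then show ?thesis by (simp add: part eval_at_sum)
    qed
    then have "ev m f = ev m (\<Sum>\<delta>\<in>red ` ?K. scale_poly (C \<delta>) (monomial (r \<delta>)))"
      by (rule ev_eqI)
    ultimately show ?thesis by (rule rev_image_eqI)
  qed
  ultimately have "(PLift m k :: ('a vec set \<Rightarrow> 'a) set) = ev m ` Poly D"
    unfolding PLift by blast
  then show ?thesis
    by (intro exI[of _ D]) (simp add: D_def)
qed

end
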